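(* Let $n\ge 1$ and $1\le r\le n+1$ be integers and let $A>1$ be a real number. Let $D_{n,r}(A)$ be the number of gap vectors $\mathbf a\in\mathcal A_{n,r}$ for which $M(n,r)/T_{\mathbf a}\le A$. Then $$N(n,r)\le M(n,r)\,H_{D_{n,r}(A)}+\frac{\binom{n+1}{r}}{A}\,M(n,r),$$ where $H_q=1+\frac12+\cdots+\frac1q$.
   Context: $B_n=2^{[n]}$ is the Boolean lattice of all subsets of $[n]=\{1,\dots,n\}$ ordered by inclusion. A chain is a set of pairwise comparable elements; a chain $C$ covers a chain $D$ if $D\subseteq C$. For $1\le r\le n+1$, $N(n,r)$ is the least number of chains in $B_n$ such that every strict chain $F_1\subset F_2\subset\cdots\subset F_r$ of size $r$ in $B_n$ is covered by at least one of them. Let $\mathcal A_{n,r}$ (the set of admissible gap vectors) be the set of integer vectors $\mathbf a=(a_0,a_1,\dots,a_r)$ with $a_0,a_r\ge 0$, $a_i\ge 1$ for $1\le i\le r-1$, and $a_0+\cdots+a_r=n$. For $\mathbf a\in\mathcal A_{n,r}$ put $T_{\mathbf a}=\binom{n}{a_0,a_1,\dots,a_r}=\frac{n!}{a_0!\cdots a_r!}$ (the number of strict $r$-chains $F_1\subset\cdots\subset F_r$ in $B_n$ with $|F_1|=a_0$, $|F_{i+1}\setminus F_i|=a_i$ for $1\le i\le r-1$, and $n-|F_r|=a_r$). Define $M(n,r)=\max_{\mathbf a\in\mathcal A_{n,r}}T_{\mathbf a}$. *)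

theory Defs
  imports "HOL-Analysis.Harmonic_Numbers"
begin

text \<open>A chain of \<open>B\<^sub>n\<close> is an element of \<^term>\<open>chains (Pow {1..n})\<close>. A strict
  \<open>r\<close>-chain \<open>F\<^sub>1 \<subset> \<dots> \<subset> F\<^sub>r\<close> is the list \<open>[F\<^sub>1, \<dots>, F\<^sub>r]\<close>, covered by \<open>C\<close> when its set of
  entries is contained in \<open>C\<close>.\<close>

definition strict_chains :: "nat \<Rightarrow> nat \<Rightarrow> nat set list set" where
  "strict_chains n r =
     {Fs. length Fs = r \<and> set Fs \<subseteq> Pow {1..n} \<and> sorted_wrt (\<subset>) Fs}"

definition covering_family :: "nat \<Rightarrow> nat \<Rightarrow> nat set set set \<Rightarrow> bool" where
  "covering_family n r \<C> \<longleftrightarrow>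
     \<C> \<subseteq> chains (Pow {1..n}) \<and> (\<forall>Fs \<in> strict_chains n r. \<exists>C \<in> \<C>. set Fs \<subseteq> C)"

text \<open>Every covering family is finite (it consists of subsets of a finite set), and the family of
  all chains is covering, so the minimum below is attained.\<close>

definition chain_cover_number :: "nat \<Rightarrow> nat \<Rightarrow> nat" where
  "chain_cover_number n r = (LEAST k. \<exists>\<C>. covering_family n r \<C> \<and> card \<C> = k)"

text \<open>The vector \<open>(a\<^sub>0, \<dots>, a\<^sub>r)\<close> is a list of length \<open>r + 1\<close>; all its entries are
  nonnegative, so the entries are natural numbers.\<close>

definition gap_vectors :: "nat \<Rightarrow> nat \<Rightarrow> nat list set" where
  "gap_vectors n r =
     {a. length a = r + 1 \<and> (\<forall>i \<in> {1..<r}. a ! i \<ge> 1) \<and> (\<Sum>i\<le>r. a ! i) = n}"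

definition gap_count :: "nat \<Rightarrow> nat \<Rightarrow> nat list \<Rightarrow> real" where
  "gap_count n r a = fact n / (\<Prod>i\<le>r. fact (a ! i))"

definition max_gap_count :: "nat \<Rightarrow> nat \<Rightarrow> real" where
  "max_gap_count n r = Max (gap_count n r ` gap_vectors n r)"

definition num_large_gaps :: "nat \<Rightarrow> nat \<Rightarrow> real \<Rightarrow> nat" where
  "num_large_gaps n r A = card {a \<in> gap_vectors n r. max_gap_count n r / gap_count n r a \<le> A}"

end

theory Submission
  imports Defs "HOL-Combinatorics.Multiset_Permutations"
begin

text \<open>
  Every ordering of \<open>{1..n}\<close> gives a maximal chain, namely its prefix sets. A strict chain with gap
  vector \<open>a\<close> lies in at least \<open>\<Prod>i\<le>r. a\<^sub>i!\<close> of these maximal chains, because the differences of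
  consecutive members may be ordered independently of each other
  (\<open>prod_fact_gaps_le_card_orderings_through\<close>). On the other hand, a maximal chain contains at
  most one strict \<open>r\<close>-chain with a given gap vector (\<open>gaps_inj_on_chain\<close>), since a member of a
  chain of finite sets is determined by its size.

  Call a gap vector large if \<open>M / T\<^sub>a \<le> A\<close>. The strict chains with large gap vectors are covered by
  maximal chains. Giving every ordering the weight \<open>M / n!\<close> is a fractional cover of total weight
  \<open>M\<close>, because the weight on a strict chain of gap vector \<open>a\<close> is at least \<open>M / T\<^sub>a \<ge> 1\<close>. As each
  maximal chain contains at most \<open>D\<close> of the strict chains in question, the theorem of Lovasz and
  Chvatal on greedy covers (\<open>greedy_cover_le_harm_times_fractional_cover\<close>) yields an integral cover
  of size at most \<open>M * harm D\<close>. Each remaining strict chain is covered by itself: the remaining gap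
  vectors number at most \<open>(n + 1) choose r\<close>, and each of them is the gap vector of at most
  \<open>T\<^sub>a < M / A\<close> strict chains (\<open>card_chains_with_gaps_le\<close>).
\<close>

section \<open>Greedy covers and fractional covers\<close>

text \<open>The tail \<open>1/(m+1) + \<dots> + 1/(m+j)\<close> of the harmonic sum consists of \<open>j\<close> terms that are at least
  \<open>1/k\<close>.\<close>

lemma harm_add_quotient_le:
  assumes "m + j \<le> k"
  shows "harm m + real j / real k \<le> (harm (m + j) :: real)"
  using assms
proof (induction j)
  case (Suc j)
  have "1 / real k \<le> 1 / real (Suc (m + j))"
    using Suc.prems by (intro divide_left_mono) auto
  with Suc show ?case
    by (simp add: harm_Suc add_divide_distrib inverse_eq_divide)
qed simp

text \<open>The greedy algorithm, which always takes a set with the largest number of uncovered points.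
  The price of a point is \<open>1/k\<close> if it becomes covered by a set that covers \<open>k\<close> new points, so that
  the prices add up to the number of sets taken. When a set still has \<open>m\<close> uncovered points, the
  greedy choice makes the next price at most \<open>1/m\<close>; hence the points of any one set cost at most a
  harmonic sum.\<close>

lemma greedy_cover_prices:
  fixes E :: "'i \<Rightarrow> 'e set"
  assumes "finite I" "finite U" "U \<subseteq> (\<Union>i\<in>I. E i)"
  shows "\<exists>G p. G \<subseteq> I \<and> U \<subseteq> (\<Union>i\<in>G. E i) \<and> (\<forall>e\<in>U. 0 \<le> p e) \<and>
           real (card G) \<le> (\<Sum>e\<in>U. p e) \<and>
           (\<forall>i\<in>I. (\<Sum>e\<in>E i \<inter> U. p e) \<le> (harm (card (E i \<inter> U)) :: real))"
  using assms(2,3)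
proof (induction U rule: finite_psubset_induct)
  case (psubset U)
  show ?case
  proof (cases "U = {}")
    case True
    then show ?thesis by (intro exI[of _ "{}"] exI[of _ "\<lambda>_. 0"]) (auto simp: harm_nonneg)
  next
    case False
    define f where "f i = card (E i \<inter> U)" for i
    from False psubset.prems have "I \<noteq> {}" by auto
    then have "Max (f ` I) \<in> f ` I" using assms(1) by (intro Max_in) auto
    then obtain s where s: "s \<in> I" "\<And>i. i \<in> I \<Longrightarrow> f i \<le> f s"
      using assms(1) by (auto simp: image_iff) (metis Max_ge finite_imageI imageI)
    from False psubset.prems obtain e i where ei: "e \<in> U" "i \<in> I" "e \<in> E i" by blast
    then have "0 < f i" using psubset.hyps by (auto simp: f_def card_gt_0_iff)
    with s(2)[OF ei(2)] have pos: "0 < f s" by simp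
    define U' where "U' = U - E s"
    have "E s \<inter> U \<noteq> {}" using pos by (auto simp: f_def)
    then have "U' \<subset> U" by (auto simp: U'_def)
    moreover have "U' \<subseteq> (\<Union>i\<in>I. E i)" using psubset.prems by (auto simp: U'_def)
    ultimately obtain G p where
      G: "G \<subseteq> I" "U' \<subseteq> (\<Union>i\<in>G. E i)" and p: "\<forall>e\<in>U'. 0 \<le> p e"
      and card: "real (card G) \<le> (\<Sum>e\<in>U'. p e)"
      and harm: "\<And>i. i \<in> I \<Longrightarrow> (\<Sum>e\<in>E i \<inter> U'. p e) \<le> (harm (card (E i \<inter> U')) :: real)"
      using psubset.IH[of U'] by meson
    define q where "q e = (if e \<in> E s then 1 / real (f s) else p e)" for e
    have q_sum: "(\<Sum>e\<in>B \<inter> U. q e)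
        = (\<Sum>e\<in>B \<inter> U'. p e) + real (card (B \<inter> (E s \<inter> U))) / real (f s)" for B
    proof -
      have "(\<Sum>e\<in>B \<inter> U. q e) = (\<Sum>e\<in>B \<inter> U'. q e) + (\<Sum>e\<in>B \<inter> (E s \<inter> U). q e)"
        using psubset.hyps by (subst sum.union_disjoint[symmetric])
          (auto simp: U'_def intro!: sum.cong)
      moreover have "(\<Sum>e\<in>B \<inter> U'. q e) = (\<Sum>e\<in>B \<inter> U'. p e)"
        by (intro sum.cong) (auto simp: q_def U'_def)
      moreover have "(\<Sum>e\<in>B \<inter> (E s \<inter> U). q e) = (\<Sum>e\<in>B \<inter> (E s \<inter> U). 1 / real (f s))"
        by (intro sum.cong) (auto simp: q_def)
      ultimately show ?thesis by simp
    qed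
    show ?thesis
    proof (intro exI[of _ "insert s G"] exI[of _ q] conjI ballI)
      show "insert s G \<subseteq> I" using s(1) G(1) by simp
      show "U \<subseteq> (\<Union>i\<in>insert s G. E i)" using G(2) by (auto simp: U'_def)
      show "0 \<le> q e" if "e \<in> U" for e using p that by (auto simp: q_def U'_def)
      have "(\<Sum>e\<in>U. q e) = (\<Sum>e\<in>U'. p e) + 1"
        using q_sum[of UNIV] pos by (simp add: f_def)
      moreover have "card (insert s G) \<le> card G + 1"
        by (simp add: card_insert_if finite_subset[OF G(1) assms(1)])
      ultimately show "real (card (insert s G)) \<le> (\<Sum>e\<in>U. q e)" using card by linarith
    next
      fix i assume i: "i \<in> I"
      let ?j = "card (E i \<inter> (E s \<inter> U))"
      have "card (E i \<inter> U) = card (E i \<inter> U') + ?j"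
        using psubset.hyps by (subst card_Un_disjoint[symmetric])
          (auto simp: U'_def intro!: arg_cong[where f = card])
      with harm_add_quotient_le[of "card (E i \<inter> U')" ?j "f s"] s(2)[OF i] harm[OF i]
      show "(\<Sum>e\<in>E i \<inter> U. q e) \<le> harm (card (E i \<inter> U))"
        by (simp add: q_sum f_def)
    qed
  qed
qed

text \<open>Averaging the prices over the fractional cover \<open>w\<close>: by the covering condition the prices add
  up to at most the weighted sum of the costs of the sets, each of which is at most \<open>harm d\<close>.\<close>

theorem greedy_cover_le_harm_times_fractional_cover:
  fixes E :: "'i \<Rightarrow> 'e set" and w :: "'i \<Rightarrow> real"
  assumes fin: "finite I" "finite U"
    and w: "\<And>i. i \<in> I \<Longrightarrow> 0 \<le> w i"
    and frac: "\<And>e. e \<in> U \<Longrightarrow> 1 \<le> (\<Sum>i\<in>{i\<in>I. e \<in> E i}. w i)"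
    and d: "\<And>i. i \<in> I \<Longrightarrow> card (E i \<inter> U) \<le> d"
  obtains G where "G \<subseteq> I" "U \<subseteq> (\<Union>i\<in>G. E i)" "real (card G) \<le> (\<Sum>i\<in>I. w i) * harm d"
proof -
  have "U \<subseteq> (\<Union>i\<in>I. E i)"
  proof
    fix e assume "e \<in> U"
    from frac[OF this] have "{i\<in>I. e \<in> E i} \<noteq> {}" by (metis sum.empty not_one_le_zero)
    then show "e \<in> (\<Union>i\<in>I. E i)" by auto
  qed
  from greedy_cover_prices[OF fin this] obtain G p where
    G: "G \<subseteq> I" "U \<subseteq> (\<Union>i\<in>G. E i)" and p: "\<forall>e\<in>U. 0 \<le> p e"
    and card: "real (card G) \<le> (\<Sum>e\<in>U. p e)"
    and harm: "\<And>i. i \<in> I \<Longrightarrow> (\<Sum>e\<in>E i \<inter> U. p e) \<le> (harm (card (E i \<inter> U)) :: real)"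
    by meson
  note card
  also have "(\<Sum>e\<in>U. p e) \<le> (\<Sum>e\<in>U. \<Sum>i\<in>{i\<in>I. e \<in> E i}. p e * w i)"
    using frac p by (intro sum_mono) (auto simp: sum_distrib_left[symmetric] mult_le_cancel_left1)
  also have "\<dots> = (\<Sum>i\<in>I. \<Sum>e\<in>{e\<in>U. e \<in> E i}. p e * w i)"
    by (rule sum.swap_restrict[OF fin(2,1)])
  also have "\<dots> = (\<Sum>i\<in>I. w i * (\<Sum>e\<in>E i \<inter> U. p e))"
    by (intro sum.cong) (auto simp: sum_distrib_left mult.commute intro!: sum.cong)
  also have "\<dots> \<le> (\<Sum>i\<in>I. w i * harm d)"
    using harm d w by (intro sum_mono mult_left_mono) (auto intro: order_trans[OF _ harm_mono])
  finally show ?thesis using that G by (simp add: sum_distrib_right)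
qed

section \<open>Gaps of a chain and the orderings through it\<close>

text \<open>The bottom \<open>X\<close> is a parameter so that the recursion can move it up to the first member of
  the chain. The gap vector of the context is the case \<open>X = {}\<close>, \<open>V = {1..n}\<close>.\<close>

fun gaps :: "'a set \<Rightarrow> 'a set list \<Rightarrow> 'a set \<Rightarrow> nat list" where
  "gaps X [] V = [card (V - X)]"
| "gaps X (F # Fs) V = card (F - X) # gaps F Fs V"

definition prefix_sets :: "'a list \<Rightarrow> 'a set set" where
  "prefix_sets xs = range (\<lambda>k. set (take k xs))"

definition orderings_through :: "'a set \<Rightarrow> 'a set list \<Rightarrow> 'a set \<Rightarrow> 'a list set" where
  "orderings_through X Fs V =
     {xs \<in> permutations_of_set (V - X). set Fs \<subseteq> (\<union>) X ` prefix_sets xs}"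

lemma length_gaps [simp]: "length (gaps X Fs V) = Suc (length Fs)"
  by (induction X Fs V rule: gaps.induct) auto

lemma sum_list_gaps:
  assumes "finite V" "sorted_wrt (\<subset>) Fs" "\<And>F. F \<in> set Fs \<Longrightarrow> X \<subseteq> F \<and> F \<subseteq> V" "X \<subseteq> V"
  shows "sum_list (gaps X Fs V) = card (V - X)"
  using assms
proof (induction X Fs V rule: gaps.induct)
  case (2 X F Fs V)
  have "sum_list (gaps F Fs V) = card (V - F)"
    using "2.prems" by (intro "2.IH") auto
  moreover have "card (V - X) = card (F - X) + card (V - F)"
  proof -
    have "V - X = (F - X) \<union> (V - F)" using "2.prems" by auto
    then show ?thesis using "2.prems"
      by (auto intro!: card_Un_disjoint intro: finite_subset)
  qed
  ultimately show ?case by simp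
qed simp

lemma gaps_nth_pos:
  assumes "\<And>F. F \<in> set Fs \<Longrightarrow> finite F" "sorted_wrt (\<subset>) (X # Fs)" "i < length Fs"
  shows "1 \<le> gaps X Fs V ! i"
  using assms
proof (induction X Fs V arbitrary: i rule: gaps.induct)
  case (2 X F Fs V)
  then show ?case
  proof (cases i)
    case 0
    have "F - X \<noteq> {}" "finite (F - X)" using 2 by auto
    then have "0 < card (F - X)" by (simp add: card_gt_0_iff)
    then show ?thesis using 0 by simp
  qed auto
qed simp

text \<open>Two members of \<open>\<C>\<close> that contain \<open>X\<close> and exceed it by equally many elements are comparable
  and of the same finite size, hence equal; so the gaps determine the members from the bottom up.\<close>

lemma gaps_inj_on_chain:
  assumes "chain\<^sub>\<subseteq> \<C>" "\<And>F. F \<in> \<C> \<Longrightarrow> finite F"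
    and "set Fs \<subseteq> \<C>" "set Gs \<subseteq> \<C>" "sorted_wrt (\<subset>) Fs" "sorted_wrt (\<subset>) Gs"
    and "\<And>F. F \<in> set Fs \<union> set Gs \<Longrightarrow> X \<subseteq> F"
    and "gaps X Fs V = gaps X Gs V"
  shows "Fs = Gs"
  using assms(3-)
proof (induction Fs arbitrary: X Gs)
  case Nil
  then show ?case by (cases Gs) (auto dest: arg_cong[where f = length])
next
  case (Cons F Fs)
  then obtain G Gs' where Gs: "Gs = G # Gs'"
    by (cases Gs) (auto dest: arg_cong[where f = length])
  have mem: "F \<in> \<C>" "G \<in> \<C>" "X \<subseteq> F" "X \<subseteq> G" using Cons.prems Gs by auto
  then have fin: "finite F" "finite G" using assms(2) by auto
  have "card (F - X) = card (G - X)" using Cons.prems Gs by simp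
  moreover have "F \<subseteq> G \<or> G \<subseteq> F" using mem assms(1) by (auto simp: chain_subset_def)
  ultimately have "F - X = G - X"
    using fin by (metis Diff_mono card_subset_eq finite_Diff subset_refl)
  with mem have "F = G" by blast
  moreover have "Fs = Gs'"
    using Cons.prems Gs \<open>F = G\<close> by (intro Cons.IH[of Gs' F]) auto
  ultimately show ?case by (simp add: Gs)
qed

lemma chain_prefix_sets: "chain\<^sub>\<subseteq> (prefix_sets xs)"
  unfolding chain_subset_def prefix_sets_def
  by auto (metis nle_le set_take_subset_set_take subsetD)

text \<open>Any ordering of the first difference \<open>F - X\<close> may be followed by any ordering through the
  chain above \<open>F\<close>.\<close>

lemma prod_fact_gaps_le_card_orderings_through:
  assumes "finite V" "sorted_wrt (\<subset>) Fs" "\<And>F. F \<in> set Fs \<Longrightarrow> X \<subseteq> F \<and> F \<subseteq> V" "X \<subseteq> V"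
  shows "prod_list (map fact (gaps X Fs V)) \<le> card (orderings_through X Fs V)"
  using assms
proof (induction X Fs V rule: gaps.induct)
  case (1 X V)
  then show ?case by (simp add: orderings_through_def)
next
  case (2 X F Fs V)
  let ?A = "permutations_of_set (F - X)" and ?B = "orderings_through F Fs V"
  have fin: "finite (F - X)" using "2.prems" by (auto intro: finite_subset)
  have len: "length ys = card (F - X)" if "ys \<in> ?A" for ys
    using that by (simp add: length_finite_permutations_of_set)
  have inj: "inj_on (\<lambda>(ys, zs). ys @ zs) (?A \<times> ?B)"
    by (auto simp: inj_on_def dest!: len)
  have "ys @ zs \<in> orderings_through X (F # Fs) V" if ys: "ys \<in> ?A" and zs: "zs \<in> ?B" for ys zs
  proof -
    have set: "set ys = F - X" "set zs = V - F" "distinct ys" "distinct zs"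
      using ys zs by (auto simp: orderings_through_def permutations_of_set_def)
    have "X \<subseteq> F" "F \<subseteq> V" using "2.prems" by auto
    then have "ys @ zs \<in> permutations_of_set (V - X)"
      using set by (auto simp: permutations_of_set_def)
    moreover have "F = X \<union> set (take (length ys) (ys @ zs))" using set "2.prems" by auto
    then have "F \<in> (\<union>) X ` prefix_sets (ys @ zs)"
      unfolding prefix_sets_def by blast
    moreover have "G \<in> (\<union>) X ` prefix_sets (ys @ zs)" if "G \<in> set Fs" for G
    proof -
      from zs that obtain k where "G = F \<union> set (take k zs)"
        by (auto simp: orderings_through_def prefix_sets_def)
      then have "G = X \<union> set (take (length ys + k) (ys @ zs))"
        using set "2.prems" by auto
      then show ?thesis unfolding prefix_sets_def by blast
    qed
    ultimately show ?thesis by (auto simp: orderings_through_def)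
  qed
  then have sub: "(\<lambda>(ys, zs). ys @ zs) ` (?A \<times> ?B) \<subseteq> orderings_through X (F # Fs) V"
    by auto
  have "prod_list (map fact (gaps F Fs V)) \<le> card ?B"
    using "2.prems" by (intro "2.IH") auto
  then have "prod_list (map fact (gaps X (F # Fs) V)) \<le> card ?A * card ?B"
    using fin by (simp add: mult_le_mono)
  also have "\<dots> = card ((\<lambda>(ys, zs). ys @ zs) ` (?A \<times> ?B))"
    by (simp add: card_image[OF inj] card_cartesian_product)
  also have "\<dots> \<le> card (orderings_through X (F # Fs) V)"
    using sub by (intro card_mono) (auto simp: orderings_through_def)
  finally show ?case .
qed

section \<open>Gap vectors\<close>

text \<open>Lowering the middle entries by one turns gap vectors into arbitrary vectors of natural
  numbers with sum \<open>n + 1 - r\<close>, which are counted by stars and bars.\<close>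

lemma
  assumes "1 \<le> r" "r \<le> n + 1"
  shows finite_gap_vectors: "finite (gap_vectors n r)"
    and card_gap_vectors_le: "card (gap_vectors n r) \<le> (n + 1) choose r"
proof -
  define lower where
    "lower a = map (\<lambda>i. if 1 \<le> i \<and> i < r then a ! i - 1 else a ! i) [0..<r+1]" for a :: "nat list"
  define L where "L = {l :: nat list. length l = r + 1 \<and> sum_list l = n + 1 - r}"
  have "L \<subseteq> {l. set l \<subseteq> {..n + 1 - r} \<and> length l = r + 1}"
    by (auto simp: L_def dest: member_le_sum_list)
  then have finL: "finite L" by (rule finite_subset) (simp add: finite_lists_length_eq)
  have inj: "inj_on lower (gap_vectors n r)"
  proof (rule inj_onI)
    fix a b assume a: "a \<in> gap_vectors n r" and b: "b \<in> gap_vectors n r"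
      and eq: "lower a = lower b"
    show "a = b"
    proof (rule nth_equalityI)
      show "length a = length b" using a b by (simp add: gap_vectors_def)
      fix i assume "i < length a"
      then have i: "i < r + 1" using a by (simp add: gap_vectors_def)
      have lower_nth: "lower c ! i = (if 1 \<le> i \<and> i < r then c ! i - 1 else c ! i)" for c
        using i by (simp add: lower_def del: upt_Suc)
      show "a ! i = b ! i"
      proof (cases "1 \<le> i \<and> i < r")
        case True
        then have "1 \<le> a ! i" "1 \<le> b ! i" using a b by (auto simp: gap_vectors_def)
        moreover have "a ! i - 1 = b ! i - 1" using lower_nth[of a] lower_nth[of b] eq True by simp
        ultimately show ?thesis by simp
      next
        case False
        with lower_nth[of a] lower_nth[of b] eq show ?thesis by (simp only: if_False)
      qed
    qed
  qed
  have sub: "lower ` gap_vectors n r \<subseteq> L"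
  proof
    fix l assume "l \<in> lower ` gap_vectors n r"
    then obtain a where a: "a \<in> gap_vectors n r" and l: "l = lower a" by auto
    have pos: "0 < a ! i" if "1 \<le> i" "i < r" for i
      using a that by (force simp: gap_vectors_def)
    have "n = (\<Sum>i\<le>r. a ! i)" using a by (simp add: gap_vectors_def)
    also have "\<dots> = (\<Sum>i\<le>r. (if 1 \<le> i \<and> i < r then a ! i - 1 else a ! i)
                         + (if 1 \<le> i \<and> i < r then 1 else 0))"
      using pos by (intro sum.cong) simp_all
    also have "\<dots> = sum_list l + (\<Sum>i\<le>r. if 1 \<le> i \<and> i < r then 1 else 0)"
      by (simp add: l lower_def sum.distrib interv_sum_list_conv_sum_set_nat atLeast0LessThan
            lessThan_Suc_atMost del: upt_Suc)
    also have "(\<Sum>i\<le>r. if 1 \<le> i \<and> i < r then 1 else 0) = card {i\<in>{..r}. 1 \<le> i \<and> i < r}"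
      by (subst sum.inter_filter[symmetric]) auto
    also have "{i\<in>{..r}. 1 \<le> i \<and> i < r} = {1..<r}" by auto
    finally show "l \<in> L" using assms by (simp add: L_def l lower_def)
  qed
  show "finite (gap_vectors n r)" using finite_subset[OF sub finL] inj by (rule finite_imageD)
  have "card (gap_vectors n r) \<le> card L" using card_inj_on_le[OF inj sub finL] .
  also have "card L = (n + 1) choose (n + 1 - r)"
    using assms unfolding L_def by (subst card_length_sum_list) simp
  also have "\<dots> = (n + 1) choose r" using binomial_symmetric[OF assms(2)] by simp
  finally show "card (gap_vectors n r) \<le> (n + 1) choose r" .
qed

lemma gap_vectors_nonempty:
  assumes "1 \<le> r" "r \<le> n + 1"
  shows "gap_vectors n r \<noteq> {}"
proof -
  have "(n + 1 - r) # replicate (r - 1) 1 @ [0] \<in> gap_vectors n r"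
  proof -
    let ?a = "(n + 1 - r) # replicate (r - 1) 1 @ [0]"
    have len: "length ?a = r + 1" using assms by simp
    have "(\<Sum>i\<le>r. ?a ! i) = sum_list ?a"
      using len by (simp only: sum_list_sum_nth atLeast0LessThan lessThan_Suc_atMost Suc_eq_plus1[symmetric])
    also have "\<dots> = n" using assms by (simp add: sum_list_replicate)
    finally show ?thesis using len by (auto simp: gap_vectors_def nth_Cons nth_append split: nat.split)
  qed
  then show ?thesis by auto
qed

lemma gap_count_pos: "0 < gap_count n r a"
  by (simp add: gap_count_def prod_pos)

lemma gap_count_le_max:
  assumes "1 \<le> r" "r \<le> n + 1" "a \<in> gap_vectors n r"
  shows "gap_count n r a \<le> max_gap_count n r"
  unfolding max_gap_count_def using assms finite_gap_vectors by (intro Max_ge) auto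

lemma max_gap_count_nonneg:
  assumes "1 \<le> r" "r \<le> n + 1"
  shows "0 \<le> max_gap_count n r"
  using gap_vectors_nonempty[OF assms] gap_count_le_max[OF assms] gap_count_pos
  by (meson ex_in_conv less_imp_le order_trans)

section \<open>Strict chains of the Boolean lattice\<close>

lemma finite_strict_chains: "finite (strict_chains n r)"
proof -
  have "finite {Fs. set Fs \<subseteq> Pow {1..n} \<and> length Fs = r}" by (simp add: finite_lists_length_eq)
  then show ?thesis by (rule rev_finite_subset) (auto simp: strict_chains_def)
qed

lemma gaps_in_gap_vectors:
  assumes "Fs \<in> strict_chains n r"
  shows "gaps {} Fs {1..n} \<in> gap_vectors n r"
proof -
  let ?a = "gaps {} Fs {1..n}"
  have Fs: "length Fs = r" "set Fs \<subseteq> Pow {1..n}" "sorted_wrt (\<subset>) Fs"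
    using assms by (auto simp: strict_chains_def)
  have "(\<Sum>i\<le>r. ?a ! i) = sum_list ?a"
    by (simp add: sum_list_sum_nth atLeast0LessThan lessThan_Suc_atMost Fs)
  also have "\<dots> = n" using Fs by (subst sum_list_gaps) auto
  finally have sum: "(\<Sum>i\<le>r. ?a ! i) = n" .
  have "1 \<le> ?a ! i" if i: "i \<in> {1..<r}" for i
  proof -
    from i Fs obtain F Gs where "Fs = F # Gs" by (cases Fs) auto
    moreover have "\<And>G. G \<in> set Fs \<Longrightarrow> finite G" using Fs by (auto intro: finite_subset)
    ultimately show ?thesis using gaps_nth_pos[of Gs F "i - 1" "{1..n}"] Fs i by (auto simp: nth_Cons')
  qed
  with sum Fs show ?thesis by (simp add: gap_vectors_def)
qed

text \<open>Since \<open>n! / T\<^sub>a = \<Prod>i\<le>r. a\<^sub>i!\<close>, this is the bound by independent orderings of the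
  differences, in the form needed for weighing orderings against \<open>T\<^sub>a\<close>.\<close>

lemma fact_le_gap_count_times_card_orderings:
  assumes "Fs \<in> strict_chains n r"
  shows "fact n \<le> gap_count n r (gaps {} Fs {1..n}) * real (card (orderings_through {} Fs {1..n}))"
proof -
  let ?a = "gaps {} Fs {1..n}"
  have Fs: "length Fs = r" "set Fs \<subseteq> Pow {1..n}" "sorted_wrt (\<subset>) Fs"
    using assms by (auto simp: strict_chains_def)
  have "(\<Prod>i\<le>r. fact (?a ! i)) = prod_list (map fact ?a :: nat list)"
    by (simp add: prod.list_conv_set_nth atLeast0LessThan lessThan_Suc_atMost Fs)
  also have "\<dots> \<le> card (orderings_through {} Fs {1..n})"
    using Fs by (intro prod_fact_gaps_le_card_orderings_through) auto
  finally have "real (\<Prod>i\<le>r. fact (?a ! i)) \<le> real (card (orderings_through {} Fs {1..n}))"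
    by (rule of_nat_mono)
  then have le: "(\<Prod>i\<le>r. fact (?a ! i)) \<le> real (card (orderings_through {} Fs {1..n}))"
    by simp
  have "0 < (\<Prod>i\<le>r. fact (?a ! i) :: real)" by (simp add: prod_pos)
  then have "fact n = gap_count n r ?a * (\<Prod>i\<le>r. fact (?a ! i))"
    by (simp add: gap_count_def)
  also have "\<dots> \<le> gap_count n r ?a * real (card (orderings_through {} Fs {1..n}))"
    using le gap_count_pos by (intro mult_left_mono) (auto simp: less_imp_le)
  finally show ?thesis .
qed

lemma strict_chain_determined_by_gaps:
  assumes "Fs \<in> strict_chains n r" "Gs \<in> strict_chains n r"
    and "set Fs \<subseteq> prefix_sets xs" "set Gs \<subseteq> prefix_sets xs"
    and "gaps {} Fs {1..n} = gaps {} Gs {1..n}"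
  shows "Fs = Gs"
  using assms
  by (intro gaps_inj_on_chain[OF chain_prefix_sets[of xs], of Fs Gs "{}" "{1..n}"])
     (auto simp: strict_chains_def prefix_sets_def)

text \<open>The sets of orderings through different strict chains with the same gap vector are
  disjoint, and each contains at least \<open>n! / T\<^sub>a\<close> of the \<open>n!\<close> orderings.\<close>

lemma card_chains_with_gaps_le:
  "real (card {Fs \<in> strict_chains n r. gaps {} Fs {1..n} = a}) \<le> gap_count n r a"
proof -
  let ?S = "{Fs \<in> strict_chains n r. gaps {} Fs {1..n} = a}"
  let ?P = "\<lambda>Fs. orderings_through {} Fs {1..n}"
  have "disjoint_family_on ?P ?S"
    by (auto simp: disjoint_family_on_def orderings_through_def
        dest: strict_chain_determined_by_gaps)
  then have "(\<Sum>Fs\<in>?S. card (?P Fs)) = card (\<Union>Fs\<in>?S. ?P Fs)"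
    using finite_strict_chains[of n r]
    by (subst card_UN_disjoint) (auto simp: disjoint_family_on_def orderings_through_def)
  also have "\<dots> \<le> card (permutations_of_set {1..n})"
    by (intro card_mono) (auto simp: orderings_through_def)
  finally have "(\<Sum>Fs\<in>?S. card (?P Fs)) \<le> fact n" by simp
  then have le: "(\<Sum>Fs\<in>?S. real (card (?P Fs))) \<le> fact n"
    using of_nat_mono[where ?'a = real] by fastforce
  have "real (card ?S) * fact n = (\<Sum>Fs\<in>?S. fact n)" by simp
  also have "\<dots> \<le> (\<Sum>Fs\<in>?S. gap_count n r a * real (card (?P Fs)))"
    using fact_le_gap_count_times_card_orderings by (intro sum_mono) auto
  also have "\<dots> \<le> gap_count n r a * fact n"
    using le gap_count_pos[of n r a]
    by (simp add: sum_distrib_left[symmetric])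
  finally show ?thesis by simp
qed

section \<open>The bound on the chain cover number\<close>

text \<open>The constant weight \<open>M / n!\<close> on all orderings is a fractional cover of the strict chains, and
  the gap vector embeds the strict chains of \<open>U\<close> inside one maximal chain into \<open>L\<close>.\<close>

lemma cover_by_maximal_chains:
  assumes "1 \<le> r" "r \<le> n + 1" and L: "finite L"
    and U: "U = {Fs \<in> strict_chains n r. gaps {} Fs {1..n} \<in> L}"
  obtains G where "G \<subseteq> permutations_of_set {1..n}"
    "\<And>Fs. Fs \<in> U \<Longrightarrow> \<exists>xs\<in>G. set Fs \<subseteq> prefix_sets xs"
    "real (card G) \<le> max_gap_count n r * harm (card L)"
proof -
  let ?M = "max_gap_count n r" and ?I = "permutations_of_set {1..n}"
  define E where "E xs = {Fs. set Fs \<subseteq> prefix_sets xs}" for xs :: "nat list"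
  have M: "0 \<le> ?M" by (rule max_gap_count_nonneg[OF assms(1,2)])
  obtain G where G: "G \<subseteq> ?I" "U \<subseteq> (\<Union>xs\<in>G. E xs)"
    "real (card G) \<le> (\<Sum>xs\<in>?I. ?M / fact n) * harm (card L)"
  proof (rule greedy_cover_le_harm_times_fractional_cover[of ?I U "\<lambda>_. ?M / fact n" E "card L"])
    show "finite U" using finite_strict_chains[of n r] by (simp add: U)
    show "1 \<le> (\<Sum>xs\<in>{xs\<in>?I. Fs \<in> E xs}. ?M / fact n)" if Fs: "Fs \<in> U" for Fs
    proof -
      have chain: "Fs \<in> strict_chains n r" using Fs by (simp add: U)
      have "{xs\<in>?I. Fs \<in> E xs} = orderings_through {} Fs {1..n}"
        by (auto simp: E_def orderings_through_def)
      moreover have "fact n \<le> ?M * real (card (orderings_through {} Fs {1..n}))"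
        using fact_le_gap_count_times_card_orderings[OF chain]
          gap_count_le_max[OF assms(1,2) gaps_in_gap_vectors[OF chain]]
        by (meson mult_right_mono of_nat_0_le_iff order_trans)
      ultimately show ?thesis by (simp add: field_simps)
    qed
    show "card (E xs \<inter> U) \<le> card L" for xs
    proof (rule card_inj_on_le[where f = "\<lambda>Fs. gaps {} Fs {1..n}"])
      show "inj_on (\<lambda>Fs. gaps {} Fs {1..n}) (E xs \<inter> U)"
        by (auto simp: inj_on_def E_def U dest: strict_chain_determined_by_gaps)
    qed (auto simp: U L)
  qed (use M in auto)
  show ?thesis
  proof (rule that)
    show "G \<subseteq> ?I" by fact
    show "\<exists>xs\<in>G. set Fs \<subseteq> prefix_sets xs" if "Fs \<in> U" for Fs
      using G(2) that by (auto simp: E_def)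
    show "real (card G) \<le> ?M * harm (card L)" using G(3) by simp
  qed
qed

lemma prefix_sets_in_chains:
  assumes "xs \<in> permutations_of_set S"
  shows "prefix_sets xs \<in> chains (Pow S)"
  using assms chain_prefix_sets[of xs]
  by (auto simp: chains_def prefix_sets_def permutations_of_set_def dest: in_set_takeD)

lemma set_strict_chain_in_chains:
  assumes "Fs \<in> strict_chains n r"
  shows "set Fs \<in> chains (Pow {1..n})"
proof -
  have "F \<subseteq> G \<or> G \<subseteq> F" if "F \<in> set Fs" "G \<in> set Fs" for F G
  proof -
    from that obtain i j where "i < length Fs" "j < length Fs" "F = Fs ! i" "G = Fs ! j"
      by (metis in_set_conv_nth)
    moreover from assms have "Fs ! k \<subset> Fs ! l" if "k < l" "l < length Fs" for k l
      using that by (simp add: strict_chains_def sorted_wrt_iff_nth_less)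
    ultimately show ?thesis by (metis nat_neq_iff psubset_imp_subset subset_refl)
  qed
  then show ?thesis using assms by (auto simp: chains_def chain_subset_def strict_chains_def)
qed

theorem mainTheorem6:
  fixes n r :: nat and A :: real
  assumes "1 \<le> n" and "1 \<le> r" and "r \<le> n + 1" and "1 < A"
  shows "real (chain_cover_number n r)
    \<le> max_gap_count n r * harm (num_large_gaps n r A)
       + real ((n + 1) choose r) / A * max_gap_count n r"
proof -
  let ?M = "max_gap_count n r"
  define L where "L = {a \<in> gap_vectors n r. ?M / gap_count n r a \<le> A}"
  define S where "S = gap_vectors n r - L"
  define W where "W = {Fs \<in> strict_chains n r. gaps {} Fs {1..n} \<in> S}"
  have fin: "finite (gap_vectors n r)" by (rule finite_gap_vectors[OF assms(2,3)])
  then have finL: "finite L" by (simp add: L_def)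
  have M: "0 \<le> ?M" by (rule max_gap_count_nonneg[OF assms(2,3)])
  obtain G where G: "G \<subseteq> permutations_of_set {1..n}"
    "\<And>Fs. Fs \<in> strict_chains n r \<Longrightarrow> gaps {} Fs {1..n} \<in> L \<Longrightarrow> \<exists>xs\<in>G. set Fs \<subseteq> prefix_sets xs"
    "real (card G) \<le> ?M * harm (card L)"
    by (rule cover_by_maximal_chains[OF assms(2,3) finL refl]) (blast intro: that)
  have finG: "finite G" using G(1) by (rule finite_subset) simp
  have finW: "finite W" using finite_strict_chains[of n r] by (simp add: W_def)
  let ?\<C> = "prefix_sets ` G \<union> set ` W"
  have "covering_family n r ?\<C>"
    unfolding covering_family_def
  proof (intro conjI ballI)
    show "?\<C> \<subseteq> chains (Pow {1..n})"
      using G(1) prefix_sets_in_chains set_strict_chain_in_chains by (auto simp: W_def)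
    fix Fs assume Fs: "Fs \<in> strict_chains n r"
    show "\<exists>C\<in>?\<C>. set Fs \<subseteq> C"
    proof (cases "gaps {} Fs {1..n} \<in> L")
      case True
      then show ?thesis using G(2)[OF Fs] by auto
    next
      case False
      then have "Fs \<in> W" using Fs gaps_in_gap_vectors by (simp add: W_def S_def)
      then show ?thesis by blast
    qed
  qed
  then have "chain_cover_number n r \<le> card ?\<C>"
    unfolding chain_cover_number_def by (intro Least_le) auto
  also have "\<dots> \<le> card G + card W"
    using finG finW by (meson add_mono card_Un_le card_image_le order_trans)
  finally have N: "real (chain_cover_number n r) \<le> real (card G) + real (card W)" by linarith
  have small: "gap_count n r a \<le> ?M / A" if "a \<in> S" for a
    using that gap_count_pos[of n r a] assms(4) by (auto simp: S_def L_def field_simps)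
  have "W = (\<Union>a\<in>S. {Fs \<in> strict_chains n r. gaps {} Fs {1..n} = a})" by (auto simp: W_def)
  then have "card W \<le> (\<Sum>a\<in>S. card {Fs \<in> strict_chains n r. gaps {} Fs {1..n} = a})"
    using card_UN_le[of S] fin by (simp add: S_def)
  then have "real (card W) \<le> (\<Sum>a\<in>S. real (card {Fs \<in> strict_chains n r. gaps {} Fs {1..n} = a}))"
    using of_nat_mono[where ?'a = real] by fastforce
  also have "\<dots> \<le> (\<Sum>a\<in>S. ?M / A)"
    using card_chains_with_gaps_le small by (intro sum_mono) (meson order_trans)
  also have "\<dots> = real (card S) * (?M / A)" by simp
  also have "card S \<le> (n + 1) choose r"
    using card_mono[OF fin, of S] card_gap_vectors_le[OF assms(2,3)] by (auto simp: S_def)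
  then have "real (card S) * (?M / A) \<le> real ((n + 1) choose r) * (?M / A)"
    using M assms(4) by (intro mult_right_mono) auto
  finally have "real (card W) \<le> real ((n + 1) choose r) / A * ?M" by simp
  with N G(3) show ?thesis by (simp add: num_large_gaps_def L_def)
qed

end
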